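(* Let $p$ be a prime with $p \equiv 1 \pmod 5$, let $\alpha\ge 1$ and $q = p^{\alpha}$. Let $\zeta = e^{2\pi i/5}$ and let $(a_1,a_2,a_3,a_4)\in\mathbb Z^4$ satisfy, with $H = a_1\zeta + a_2\zeta^2 + a_3\zeta^3 + a_4\zeta^4$, the following conditions: (i) $q = a_1^2+a_2^2+a_3^2+a_4^2 - \frac12 (a_1a_2+a_2a_3+a_3a_4+a_1a_3+a_2a_4+a_1a_4)$; (ii) $a_1a_2+a_2a_3+a_3a_4 = a_1a_3+a_2a_4+a_1a_4$; (iii) $1+a_1+a_2+a_3+a_4 \equiv 0 \pmod 5$; (iv) $a_1+2a_2+3a_3+4a_4\equiv 0 \pmod 5$; (v) $p$ does not divide $H\,\sigma_2(H)$ in $\mathbb Z[\zeta]$, where $\sigma_2$ is the automorphism of $\mathbb Q(\zeta)$ with $\sigma_2(\zeta)=\zeta^2$. Let $D$ be the $4\times 2$ matrix $$D = \begin{pmatrix} a_1-a_2+a_3 & a_4\\ a_3-a_4 & a_3\\ a_1 & a_2\\ a_1-a_2+a_3-a_4 & a_1\end{pmatrix},$$ with entries reduced modulo $p$ and regarded as elements of $\mathbb F_p\subseteq \mathbb F_q$. Then any two rows of $D$ are linearly independent, and the matrix $G = D^t$ is a generator matrix of an MDS code of type $[4,2,3]$ over $\mathbb F_q$.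
   Context: An $[n,k,d]$-code over $\mathbb F_q$ is a linear subspace of $\mathbb F_q^n$ of dimension $k$ and minimum (Hamming) distance $d$. It is called MDS (maximum distance separable) if $n+1=k+d$. A generator matrix of a linear code is a matrix whose rows form a basis of the code. Conditions (i)–(v) are a known arithmetic characterization of Jacobi sums of order $5$: for a generator $\gamma$ of $\mathbb F_q^*$ let $\chi$ be the character of $\mathbb F_q^*$ with $\chi(\gamma)=\zeta$, and put $J(1,1) = \sum_{v\in\mathbb F_q,\ v\ne 0,-1}\chi(v)\chi(v+1)$. Then integers $(a_1,a_2,a_3,a_4)$ satisfy (i)–(v) if and only if $a_1\zeta+a_2\zeta^2+a_3\zeta^3+a_4\zeta^4$ is one of the conjugates of $J(1,1)$ under $\mathrm{Gal}(\mathbb Q(\zeta)/\mathbb Q)$, equivalently, if and only if it equals $J(1,1)$ for some choice of the generator $\gamma$ of $\mathbb F_q^*$. *)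

theory Defs
  imports
    "HOL-Analysis.Analysis"
    "HOL-Computational_Algebra.Primes"
    "HOL-Computational_Algebra.Polynomial"
    "HOL-Number_Theory.Cong"
begin

(* The index 4 :: 4 is the residue 0; nevertheless the list is read off in the order 1, 2, 3, 4. *)
lemma vector_4:
  "(vector [w, x, y, z] :: 'a::zero^4) $ 1 = w"
  "(vector [w, x, y, z] :: 'a::zero^4) $ 2 = x"
  "(vector [w, x, y, z] :: 'a::zero^4) $ 3 = y"
  "(vector [w, x, y, z] :: 'a::zero^4) $ 4 = z"
  unfolding vector_def by simp_all

definition hamming_distance :: "'a^'n \<Rightarrow> 'a^'n \<Rightarrow> nat" where
  "hamming_distance x y = card {i. x $ i \<noteq> y $ i}"

(* Unspecified for codes with at most one word. *)
definition min_distance :: "('a^'n) set \<Rightarrow> nat" where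
  "min_distance C = Min {hamming_distance x y | x y. x \<in> C \<and> y \<in> C \<and> x \<noteq> y}"

definition is_code :: "nat \<Rightarrow> nat \<Rightarrow> nat \<Rightarrow> ('a::field^'n) set \<Rightarrow> bool" where
  "is_code n k d C \<longleftrightarrow>
     CARD('n) = n \<and> vec.subspace C \<and> vec.dim C = k \<and> min_distance C = d"

definition is_MDS :: "('a::field^'n) set \<Rightarrow> bool" where
  "is_MDS C \<longleftrightarrow> vec.subspace C \<and> CARD('n) + 1 = vec.dim C + min_distance C"

(* Injectivity is needed because rows G is a set and would hide repeated rows. *)
definition is_generator_matrix :: "'a::field^'n^'k \<Rightarrow> ('a^'n) set \<Rightarrow> bool" where
  "is_generator_matrix G C \<longleftrightarrow>
     inj (\<lambda>i. row i G) \<and> vec.independent (rows G) \<and> vec.span (rows G) = C"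

definition is_subfield :: "'a::field set \<Rightarrow> bool" where
  "is_subfield K \<longleftrightarrow> 0 \<in> K \<and> 1 \<in> K \<and>
     (\<forall>x\<in>K. \<forall>y\<in>K. x + y \<in> K \<and> x * y \<in> K) \<and> (\<forall>x\<in>K. - x \<in> K \<and> inverse x \<in> K)"

(* The field Q(z): every subfield of a field of characteristic 0 contains the rationals. *)
definition rat_adjoin :: "'a::field_char_0 \<Rightarrow> 'a set" where
  "rat_adjoin z = \<Inter> {K. is_subfield K \<and> z \<in> K}"

(* The ring Z[z]. *)
definition int_adjoin :: "'a::comm_ring_1 \<Rightarrow> 'a set" where
  "int_adjoin z = range (\<lambda>f :: int poly. poly (map_poly of_int f) z)"

definition dvd_in :: "'a::comm_ring_1 set \<Rightarrow> 'a \<Rightarrow> 'a \<Rightarrow> bool" where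
  "dvd_in R x y \<longleftrightarrow> (\<exists>z\<in>R. y = x * z)"

(* Only the restriction of f to K is constrained. *)
definition is_field_automorphism :: "'a::field set \<Rightarrow> ('a \<Rightarrow> 'a) \<Rightarrow> bool" where
  "is_field_automorphism K f \<longleftrightarrow> bij_betw f K K \<and> f 1 = 1 \<and>
     (\<forall>x\<in>K. \<forall>y\<in>K. f (x + y) = f x + f y \<and> f (x * y) = f x * f y)"

end

(*
For a fifth root of unity w \<noteq> 1 in F_q put h(w) = a_1 w + a_2 w^2 + a_3 w^3 + a_4 w^4. Conditions
(i) and (ii) say that H times its complex conjugate is q, hence h(w) h(w^4) = 0 for all such w. Since
p splits completely in Z[\<zeta>], condition (v) provides a w with h(w) \<noteq> 0 and h(w^2) \<noteq> 0, and so
h(w^4) = h(w^3) = 0. Fourier inversion then expresses 5 a_j as a linear form in u = h(w) and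
v = h(w^2), and in these coordinates five times each 2 x 2 minor of D is a unit of Z[w] times u v.
*)

theory Submission
  imports Defs
begin

section \<open>Codes spanned by two rows whose minors are nonzero\<close>

lemma independent_pair_if_minor_nonzero:
  fixes x y :: "'a::field^'n"
  assumes "x $ i * y $ j \<noteq> x $ j * y $ i"
  shows "x \<noteq> y" and "vec.independent {x, y}"
proof -
  show "x \<noteq> y"
    using assms by (auto simp: mult.commute)
  have "y \<noteq> 0"
    using assms by auto
  moreover have "x \<notin> vec.span {y}"
    using assms by (auto simp: vec.span_singleton algebra_simps)
  ultimately show "vec.independent {x, y}"
    using \<open>x \<noteq> y\<close> by (simp add: vec.independent_insert vec.dependent_single)
qed

text \<open>Distances are bounded by \<open>CARD('n)\<close>, so the set under \<open>Min\<close> is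
  finite even over an infinite field, and \<open>Min\<close> is a true minimum.\<close>

lemma min_distance_eqI:
  fixes C :: "('a^'n) set"
  assumes "\<And>x y. x \<in> C \<Longrightarrow> y \<in> C \<Longrightarrow> x \<noteq> y \<Longrightarrow> d \<le> hamming_distance x y"
    and "x \<in> C" "y \<in> C" "x \<noteq> y" "hamming_distance x y \<le> d"
  shows "min_distance C = d"
proof -
  let ?S = "{hamming_distance x y | x y. x \<in> C \<and> y \<in> C \<and> x \<noteq> y}"
  have "?S \<subseteq> {..CARD('n)}"
    by (auto simp: hamming_distance_def intro: card_mono)
  then have "finite ?S"
    using finite_subset by blast
  moreover have "d \<in> ?S"
    using assms by (smt (verit, best) antisym mem_Collect_eq)
  ultimately show ?thesis
    unfolding min_distance_def using assms(1) by (intro Min_eqI) auto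
qed

text \<open>Two vanishing coordinates of a codeword form a homogeneous 2 x 2 system whose
  determinant is a minor of \<open>D\<close>, so a nonzero codeword has at most one zero coordinate.
  A nonzero combination of the two generators that kills a chosen coordinate attains the
  bound.\<close>

lemma MDS_if_minors_nonzero:
  fixes D :: "'a::field^2^'n"
  assumes minor: "\<And>i j. i \<noteq> j \<Longrightarrow> D $ i $ 1 * D $ j $ 2 \<noteq> D $ j $ 1 * D $ i $ 2"
    and card: "CARD('n) \<ge> 2"
  defines "C \<equiv> vec.span (rows (transpose D))"
  shows "is_generator_matrix (transpose D) C" "is_code CARD('n) 2 (CARD('n) - 1) C" "is_MDS C"
proof -
  define r where "r = (\<lambda>k. row k (transpose D))"
  have r: "r k $ i = D $ i $ k" for k i
    by (simp add: r_def row_def transpose_def)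
  have rows: "rows (transpose D) = {r 1, r 2}"
  proof -
    have "rows (transpose D) = range r"
      by (auto simp: rows_def r_def)
    then show ?thesis
      by (simp add: UNIV_2)
  qed
  obtain i0 j0 :: 'n where "i0 \<noteq> j0"
    using card card_le_Suc0_iff_eq[of "UNIV :: 'n set"] by auto
  have minor': "r 1 $ i * r 2 $ j \<noteq> r 1 $ j * r 2 $ i" if "i \<noteq> j" for i j
    using minor[OF that] by (simp add: r)
  note indep = independent_pair_if_minor_nonzero[OF minor'[OF \<open>i0 \<noteq> j0\<close>]]
  have "inj r"
    using indep(1) by (intro injI) (metis exhaust_2)
  with indep show "is_generator_matrix (transpose D) C"
    unfolding is_generator_matrix_def rows C_def by (simp add: r_def)
  have dim: "vec.dim C = 2"
    using indep unfolding C_def rows by (simp add: vec.dim_eq_card_independent)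
  have subspace: "vec.subspace C"
    by (simp add: C_def)
  have C: "x \<in> C \<longleftrightarrow> (\<exists>s t. x = s *s r 1 + t *s r 2)" for x
    unfolding C_def rows by (simp add: vec.span_breakdown_eq vec.span_singleton image_iff diff_eq_eq add.commute)
  have zero: "x = 0" if "x \<in> C" "x $ i = 0" "x $ j = 0" "i \<noteq> j" for x i j
  proof -
    obtain s t where x: "x = s *s r 1 + t *s r 2"
      using \<open>x \<in> C\<close> C by auto
    \<comment> \<open>Cramer's rule for the coefficients \<open>s\<close> and \<open>t\<close>,
      without dividing by the minor.\<close>
    have "s * (r 1 $ i * r 2 $ j - r 1 $ j * r 2 $ i) = x $ i * r 2 $ j - x $ j * r 2 $ i"
      "t * (r 1 $ i * r 2 $ j - r 1 $ j * r 2 $ i) = x $ j * r 1 $ i - x $ i * r 1 $ j"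
      by (simp_all add: x algebra_simps)
    with that minor'[OF \<open>i \<noteq> j\<close>] have "s = 0" "t = 0"
      by simp_all
    then show "x = 0"
      by (simp add: x)
  qed
  have "min_distance C = CARD('n) - 1"
  proof (rule min_distance_eqI)
    fix x y assume "x \<in> C" "y \<in> C" "x \<noteq> y"
    then have "x - y \<in> C" "x - y \<noteq> 0"
      using subspace vec.subspace_diff by auto
    then have "card {i. x $ i = y $ i} \<le> 1"
      using zero[of "x - y"] by (auto simp: card_le_Suc0_iff_eq)
    moreover have "{i. x $ i \<noteq> y $ i} = - {i. x $ i = y $ i}"
      by auto
    ultimately show "CARD('n) - 1 \<le> hamming_distance x y"
      by (simp add: hamming_distance_def Compl_eq_Diff_UNIV card_Diff_subset)
  next
    \<comment> \<open>The coefficients are chosen so that coordinate \<open>i0\<close> cancels;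
      coordinate \<open>j0\<close> is then a minor up to sign, hence nonzero.\<close>
    define c where "c = r 2 $ i0 *s r 1 + (- r 1 $ i0) *s r 2"
    show "c \<in> C"
      unfolding C c_def by blast
    show "0 \<in> C"
      by (simp add: C_def vec.span_zero)
    have c: "c $ j = r 1 $ j * r 2 $ i0 - r 1 $ i0 * r 2 $ j" for j
      by (simp add: c_def)
    show "c \<noteq> 0"
      using c[of j0] minor'[OF \<open>i0 \<noteq> j0\<close>] by auto
    have "{i. c $ i \<noteq> 0 $ i} \<subseteq> - {i0}"
      by (auto simp: c)
    from card_mono[OF _ this] show "hamming_distance c 0 \<le> CARD('n) - 1"
      by (simp add: hamming_distance_def Compl_eq_Diff_UNIV card_Diff_subset)
  qed
  with dim subspace card show "is_code CARD('n) 2 (CARD('n) - 1) C" "is_MDS C"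
    by (simp_all add: is_code_def is_MDS_def)
qed

section \<open>Subfields and their automorphisms\<close>

lemma subfield_rat_adjoin: "is_subfield (rat_adjoin z)"
  unfolding rat_adjoin_def is_subfield_def by blast

lemma of_int_mem_subfield:
  assumes "is_subfield K"
  shows "of_int n \<in> K"
proof -
  have nat: "of_nat m \<in> K" for m
    using assms by (induction m) (auto simp: is_subfield_def)
  have "of_int n = of_nat (nat n) \<or> of_int n = - of_nat (nat (- n))"
    by (cases "n \<ge> 0") simp_all
  with nat assms show ?thesis
    unfolding is_subfield_def by metis
qed

lemma power_mem_subfield:
  assumes "is_subfield K" "x \<in> K"
  shows "x ^ n \<in> K"
  using assms by (induction n) (auto simp: is_subfield_def)

text \<open>Additivity is available only inside \<open>K\<close>, so the induction over the
  integers, upwards and downwards from 0, relies on all integers lying in \<open>K\<close>.\<close>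

lemma field_automorphism_of_int:
  fixes f :: "'a::field \<Rightarrow> 'a"
  assumes K: "is_subfield K" and f: "is_field_automorphism K f"
  shows "f (of_int n) = of_int n"
proof -
  note mem = of_int_mem_subfield[OF K]
  have add: "f (of_int (a + b)) = f (of_int a) + f (of_int b)" for a b
    using f mem by (simp add: is_field_automorphism_def)
  have one: "f (of_int 1) = 1"
    using f by (simp add: is_field_automorphism_def)
  have zero: "f (of_int 0) = 0"
    using add[of 0 0] by (metis add_0 add_cancel_left_left)
  show ?thesis
  proof (induction n rule: int_induct[where k = 0])
    case base
    with zero show ?case by simp
  next
    case (step1 i)
    then show ?case
      using add[of i 1] one by simp
  next
    case (step2 i)
    then show ?case
      using add[of "i - 1" 1] one by (simp add: eq_diff_eq)
  qed
qed

lemma field_automorphism_power: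
  assumes "is_subfield K" "is_field_automorphism K f" "x \<in> K"
  shows "f (x ^ n) = f x ^ n"
  using assms by (induction n) (auto simp: is_field_automorphism_def power_mem_subfield)

lemma int_adjoin_poly: "poly (map_poly of_int f) z \<in> int_adjoin z"
  by (auto simp: int_adjoin_def)

section \<open>Finite fields: characteristic and fifth roots of unity\<close>

lemma of_nat_CARD_eq_0: "of_nat CARD('a) = (0::'a::{ring_1,finite})"
proof -
  \<comment> \<open>Translation by 1 permutes the ring, so it preserves the sum of all elements
    while adding 1 to each of them.\<close>
  have "bij (\<lambda>x::'a. x + 1)"
    by (rule bij_betwI[where g = "\<lambda>x. x - 1"]) auto
  then have "(\<Sum>x\<in>UNIV. x + 1) = \<Sum>(UNIV :: 'a set)"
    using sum.reindex_bij_betw[of "\<lambda>x. x + 1" UNIV UNIV "\<lambda>x::'a. x"] by simp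
  then show ?thesis
    by (simp add: sum.distrib)
qed

lemma CHAR_eq_if_CARD_prime_power:
  assumes "prime p" "CARD('a::{field,finite}) = p ^ \<alpha>"
  shows "CHAR('a::{field,finite}) = p"
proof -
  have "prime CHAR('a)"
    by (rule prime_CHAR_semidom) (simp add: finite_imp_CHAR_pos)
  moreover have "CHAR('a) dvd p ^ \<alpha>"
    using of_nat_CARD_eq_0[where 'a = 'a] assms by (simp only: of_nat_eq_0_iff_char_dvd)
  ultimately show ?thesis
    using assms prime_dvd_power primes_dvd_imp_eq by blast
qed

lemma power_5_minus_1_factorization:
  fixes w :: "'a::comm_ring_1"
  shows "w^5 - 1 = (w - 1) * (1 + w + w^2 + w^3 + w^4)"
  by (simp add: algebra_simps eval_nat_numeral)

lemma power_5_eq_1: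
  fixes w :: "'a::comm_ring_1"
  assumes "1 + w + w^2 + w^3 + w^4 = 0"
  shows "w^5 = 1"
  using power_5_minus_1_factorization[of w] assms by simp

lemma sum_powers_eq_0_if_power_5_eq_1:
  fixes w :: "'a::idom"
  assumes "w^5 = 1" "w \<noteq> 1"
  shows "1 + w + w^2 + w^3 + w^4 = 0"
  using power_5_minus_1_factorization[of w] assms by simp

text \<open>Multiplication by \<open>x\<close> permutes the nonzero elements and so preserves their
  product, which can be cancelled.\<close>

lemma power_card_minus_1_eq_1:
  fixes x :: "'a::{field,finite}"
  assumes "x \<noteq> 0"
  shows "x ^ (CARD('a) - 1) = 1"
proof -
  have "bij_betw ((*) x) (- {0}) (- {0})"
    using assms by (intro bij_betwI[where g = "\<lambda>y. y / x"]) auto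
  then have "(\<Prod>y\<in>-{0}. x * y) = \<Prod>(- {0})"
    using prod.reindex_bij_betw[of "(*) x" "- {0}" "- {0}" "\<lambda>y. y"] by simp
  moreover have "\<Prod>(- {0::'a}) \<noteq> 0"
    by simp
  ultimately have "x ^ card (- {0::'a}) = 1"
    by (simp add: prod.distrib)
  then show ?thesis
    by (simp add: Compl_eq_Diff_UNIV card_Diff_subset)
qed

text \<open>With m = (|F| - 1) / 5, the polynomial X^m - 1 has at most m roots, fewer than the 5m
  nonzero elements. For a nonzero non-root x, the power x^m is a fifth root of unity other than
  1.\<close>

lemma exists_primitive_fifth_root:
  assumes "CARD('a::{field,finite}) mod 5 = 1"
  obtains w :: "'a::{field,finite}" where "1 + w + w^2 + w^3 + w^4 = 0"
proof -
  have two: "2 \<le> CARD('a)"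
    using card_mono[of UNIV "{0::'a, 1}"] by simp
  define m where "m = (CARD('a) - 1) div 5"
  have m: "CARD('a) - 1 = m * 5"
    using assms two unfolding m_def by presburger
  with two have "m > 0"
    by (cases m) auto
  define P :: "'a poly" where "P = monom 1 m - 1"
  have "coeff P m = 1"
    using \<open>m > 0\<close> by (simp add: P_def)
  then have "P \<noteq> 0"
    by auto
  have "degree P \<le> m"
    unfolding P_def by (intro degree_diff_le) (auto simp: degree_monom_le)
  have "card {x. poly P x = 0} \<le> m"
    using card_poly_roots_bound[OF \<open>P \<noteq> 0\<close>] \<open>degree P \<le> m\<close> by simp
  also have "m < card (- {0::'a})"
    using m \<open>m > 0\<close> by (simp add: Compl_eq_Diff_UNIV card_Diff_subset)
  finally obtain x where "x \<noteq> 0" "poly P x \<noteq> 0"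
    using card_mono[of "{x. poly P x = 0}" "- {0}"] by fastforce
  then have "x ^ m \<noteq> 1" "(x ^ m) ^ 5 = 1"
    using power_card_minus_1_eq_1[OF \<open>x \<noteq> 0\<close>] m
    by (auto simp: P_def poly_monom power_mult)
  then show thesis
    using that sum_powers_eq_0_if_power_5_eq_1 by blast
qed

section \<open>Arithmetic and Fourier inversion at primitive fifth roots of unity\<close>

lemma fifth_root_powers:
  fixes w :: "'a::comm_ring_1"
  assumes "1 + w + w^2 + w^3 + w^4 = 0"
  shows "(w^2)^2 = w^4" "(w^2)^3 = w" "(w^2)^4 = w^3"
    and "(w^3)^2 = w" "(w^3)^3 = w^4" "(w^3)^4 = w^2"
    and "(w^4)^2 = w^3" "(w^4)^3 = w^2" "(w^4)^4 = w"
proof -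
  have "w ^ (5 * k + l) = w ^ l" for k l
    using power_5_eq_1[OF assms] by (simp add: power_add power_mult)
  from this[of 0 4] this[of 1 1] this[of 1 3] this[of 1 4] this[of 2 2] this[of 3 1]
  show "(w^2)^2 = w^4" "(w^2)^3 = w" "(w^2)^4 = w^3"
    and "(w^3)^2 = w" "(w^3)^3 = w^4" "(w^3)^4 = w^2"
    and "(w^4)^2 = w^3" "(w^4)^3 = w^2" "(w^4)^4 = w"
    by (simp_all flip: power_mult)
qed

lemma cyclotomic_5_powers:
  fixes w :: "'a::comm_ring_1"
  assumes "1 + w + w^2 + w^3 + w^4 = 0"
  shows "1 + w^2 + (w^2)^2 + (w^2)^3 + (w^2)^4 = 0"
    and "1 + w^3 + (w^3)^2 + (w^3)^3 + (w^3)^4 = 0"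
    and "1 + w^4 + (w^4)^2 + (w^4)^3 + (w^4)^4 = 0"
  using assms unfolding fifth_root_powers[OF assms] by (simp_all add: algebra_simps)

lemma mult_sigma2_expansion:
  fixes w :: "'a::comm_ring_1"
  assumes "1 + w + w^2 + w^3 + w^4 = 0"
  shows "(a1 * w + a2 * w^2 + a3 * w^3 + a4 * w^4) * (a1 * w^2 + a2 * w^4 + a3 * w + a4 * w^3)
    = (a1*a2 + a2*a4 + a1*a3 + a3*a4) + (a2^2 + a3*a4 + a1*a4) * w + (a4^2 + a1*a3 + a2*a3) * w^2
      + (a1^2 + a2*a3 + a2*a4) * w^3 + (a3^2 + a1*a4 + a1*a2) * w^4" (is "?l = ?r")
proof -
  \<comment> \<open>A polynomial identity: the last factor is the quotient that arises when the
    exponents 5 to 8 are reduced by w^5 = 1.\<close>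
  have "?l = ?r + (w^5 - 1) * ((a1*a2 + a2*a4 + a1*a3 + a3*a4) + (a2^2 + a3*a4 + a1*a4) * w
      + (a2*a3 + a4^2) * w^2 + a2*a4 * w^3)"
    by (simp add: algebra_simps eval_nat_numeral)
  then show ?thesis
    by (simp add: power_5_eq_1[OF assms])
qed

text \<open>Modulo w^5 = 1 the product is the sum of squares plus one coefficient times w + w^4 plus
  another times w^2 + w^3. By \<open>eq\<close> the two coefficients agree, and w + w^2 + w^3 + w^4
  = -1.\<close>

lemma mult_conjugate_expansion:
  fixes w :: "'a::comm_ring_1"
  assumes w: "1 + w + w^2 + w^3 + w^4 = 0"
    and eq: "a1*a2 + a2*a3 + a3*a4 = a1*a3 + a2*a4 + a1*a4"
  shows "(a1 * w + a2 * w^2 + a3 * w^3 + a4 * w^4) * (a1 * w^4 + a2 * w^3 + a3 * w^2 + a4 * w)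
    = a1^2 + a2^2 + a3^2 + a4^2 - (a1*a3 + a2*a4 + a1*a4)" (is "?l = ?S - ?B")
proof -
  have "?l = ?S + (a1*a2 + a2*a3 + a3*a4) * (w + w^4) + ?B * (w^2 + w^3)
      + (w^5 - 1) * (?S + (a1*a2 + a2*a3 + a3*a4) * w + (a1*a3 + a2*a4) * w^2 + a1*a4 * w^3)"
    by (simp add: algebra_simps eval_nat_numeral)
  also have "\<dots> = ?S - ?B + ?B * (1 + w + w^2 + w^3 + w^4)"
    unfolding eq power_5_eq_1[OF w] by (simp add: algebra_simps)
  finally show ?thesis
    by (simp only: w mult_zero_right add_0_right)
qed

text \<open>The discrete Fourier transform on Z/5 of a sequence with zeroth entry 0. Its value at 1
  is therefore -(u + v + s + t), which accounts for the -1 in every factor.\<close>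

lemma fourier_inversion_at_fifth_roots:
  fixes w a1 a2 a3 a4 :: "'a::field"
  assumes w: "1 + w + w^2 + w^3 + w^4 = 0"
    and u: "u = a1 * w + a2 * w^2 + a3 * w^3 + a4 * w^4"
    and v: "v = a1 * w^2 + a2 * w^4 + a3 * w + a4 * w^3"
    and s: "s = a1 * w^3 + a2 * w + a3 * w^4 + a4 * w^2"
    and t: "t = a1 * w^4 + a2 * w^3 + a3 * w^2 + a4 * w"
  shows "5 * a1 = u * (w^4 - 1) + v * (w^3 - 1) + s * (w^2 - 1) + t * (w - 1)"
    "5 * a2 = u * (w^3 - 1) + v * (w - 1) + s * (w^4 - 1) + t * (w^2 - 1)"
    "5 * a3 = u * (w^2 - 1) + v * (w^4 - 1) + s * (w - 1) + t * (w^3 - 1)"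
    "5 * a4 = u * (w - 1) + v * (w^2 - 1) + s * (w^3 - 1) + t * (w^4 - 1)"
proof -
  have w4: "w^4 = - 1 - w - w^2 - w^3"
    using w by algebra
  \<comment> \<open>A multiplication table that brings every product of powers to an exponent below
    5; \<open>w4\<close> then passes to the basis 1, w, w^2, w^3.\<close>
  have t1: "w * w = w^2" "w * w^2 = w^3" "w^2 * w = w^3" "w * w^3 = w^4" "w^3 * w = w^4"
    "w^2 * w^2 = w^4"
    by (simp_all add: eval_nat_numeral)
  have t2: "w * w^4 = 1" "w^4 * w = 1" "w^2 * w^3 = 1" "w^3 * w^2 = 1"
    "w^2 * w^4 = w" "w^4 * w^2 = w" "w^3 * w^3 = w" "w^3 * w^4 = w^2" "w^4 * w^3 = w^2"
    "w^4 * w^4 = w^3"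
    using w by algebra+
  show "5 * a1 = u * (w^4 - 1) + v * (w^3 - 1) + s * (w^2 - 1) + t * (w - 1)"
    "5 * a2 = u * (w^3 - 1) + v * (w - 1) + s * (w^4 - 1) + t * (w^2 - 1)"
    "5 * a3 = u * (w^2 - 1) + v * (w^4 - 1) + s * (w - 1) + t * (w^3 - 1)"
    "5 * a4 = u * (w - 1) + v * (w^2 - 1) + s * (w^3 - 1) + t * (w^4 - 1)"
    unfolding u v s t
    by (simp_all only: ring_distribs mult.assoc t1 t2) (simp_all add: w4 algebra_simps)
qed

text \<open>A polynomial of degree at most 4 vanishing at the four primitive fifth roots is a
  constant multiple of 1 + X + X^2 + X^3 + X^4. Subtracting \<open>c0\<close> times the latter
  removes the constant term, and Fourier inversion of zero values gives zero coefficients.\<close>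

lemma coeffs_eq_if_zero_at_fifth_roots:
  fixes w c0 c1 c2 c3 c4 :: "'a::field"
  assumes w: "1 + w + w^2 + w^3 + w^4 = 0" and "(5::'a) \<noteq> 0"
    and zero: "\<And>x. 1 + x + x^2 + x^3 + x^4 = 0 \<Longrightarrow>
      c0 + c1 * x + c2 * x^2 + c3 * x^3 + c4 * x^4 = 0"
  shows "c1 = c0" "c2 = c0" "c3 = c0" "c4 = c0"
proof -
  have inv: "0 = (c1 - c0) * x + (c2 - c0) * x^2 + (c3 - c0) * x^3 + (c4 - c0) * x^4"
    if "1 + x + x^2 + x^3 + x^4 = 0" for x
  proof -
    have "(c1 - c0) * x + (c2 - c0) * x^2 + (c3 - c0) * x^3 + (c4 - c0) * x^4
      = (c0 + c1 * x + c2 * x^2 + c3 * x^3 + c4 * x^4) - c0 * (1 + x + x^2 + x^3 + x^4)"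
      by (simp add: algebra_simps)
    then show ?thesis
      by (simp only: zero[OF that] that mult_zero_right diff_zero)
  qed
  note inv = this[OF w] cyclotomic_5_powers[OF w, THEN this, unfolded fifth_root_powers[OF w]]
  have "5 * (c1 - c0) = 0" "5 * (c2 - c0) = 0" "5 * (c3 - c0) = 0" "5 * (c4 - c0) = 0"
    using fourier_inversion_at_fifth_roots[OF w inv] by simp_all
  then show "c1 = c0" "c2 = c0" "c3 = c0" "c4 = c0"
    using \<open>5 \<noteq> 0\<close> by auto
qed

section \<open>The six minors as multiples of u v\<close>

lemma minors_nonzero_if_conjugates_zero:
  fixes w a1 a2 a3 a4 :: "'a::field"
  defines "u \<equiv> a1 * w + a2 * w^2 + a3 * w^3 + a4 * w^4"
    and "v \<equiv> a1 * w^2 + a2 * w^4 + a3 * w + a4 * w^3"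
  assumes w: "1 + w + w^2 + w^3 + w^4 = 0" and five: "(5::'a) \<noteq> 0"
    and s: "a1 * w^3 + a2 * w + a3 * w^4 + a4 * w^2 = 0"
    and t: "a1 * w^4 + a2 * w^3 + a3 * w^2 + a4 * w = 0"
    and "u \<noteq> 0" "v \<noteq> 0"
  shows "(a1 - a2 + a3) * a3 \<noteq> (a3 - a4) * a4"
    and "(a1 - a2 + a3) * a2 \<noteq> a1 * a4"
    and "(a1 - a2 + a3) * a1 \<noteq> (a1 - a2 + a3 - a4) * a4"
    and "(a3 - a4) * a2 \<noteq> a1 * a3"
    and "(a3 - a4) * a1 \<noteq> (a1 - a2 + a3 - a4) * a3"
    and "a1 * a1 \<noteq> (a1 - a2 + a3 - a4) * a2"
proof -
  have a: "5 * a1 = u * (w^4 - 1) + v * (w^3 - 1)" "5 * a2 = u * (w^3 - 1) + v * (w - 1)"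
    "5 * a3 = u * (w^2 - 1) + v * (w^4 - 1)" "5 * a4 = u * (w - 1) + v * (w^2 - 1)"
    using fourier_inversion_at_fifth_roots[OF w u_def[THEN meta_eq_to_obj_eq]
        v_def[THEN meta_eq_to_obj_eq] s[symmetric] t[symmetric]] by simp_all
  \<comment> \<open>Each minor becomes a quadratic form in u and v whose u^2 and v^2 terms cancel.
    The entries stay multiplied by 5 to avoid division.\<close>
  have minor: "(5 * a1 - 5 * a2 + 5 * a3) * (5 * a3) - (5 * a3 - 5 * a4) * (5 * a4) =
      - 5 * ((w^4 + w^2) * u * v)"
    "(5 * a1 - 5 * a2 + 5 * a3) * (5 * a2) - (5 * a1) * (5 * a4) =
      - 5 * (w^4 * u * v)"
    "(5 * a1 - 5 * a2 + 5 * a3) * (5 * a1) - (5 * a1 - 5 * a2 + 5 * a3 - 5 * a4) * (5 * a4) =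
      - 5 * ((w^4 + w) * u * v)"
    "(5 * a3 - 5 * a4) * (5 * a2) - (5 * a1) * (5 * a3) =
      - 5 * (u * v)"
    "(5 * a3 - 5 * a4) * (5 * a1) - (5 * a1 - 5 * a2 + 5 * a3 - 5 * a4) * (5 * a3) =
      - 5 * (w * u * v)"
    "(5 * a1) * (5 * a1) - (5 * a1 - 5 * a2 + 5 * a3 - 5 * a4) * (5 * a2) =
      - 5 * ((w^3 + w) * u * v)"
    unfolding a using w by algebra+
  \<comment> \<open>Each sum is a power of w times 1 + x for a primitive fifth root x, and (1 + x)(x
    + x^3) = -1.\<close>
  have "w \<noteq> 0" "w^4 + w^2 \<noteq> 0" "w^4 + w \<noteq> 0" "w^3 + w \<noteq> 0"
    using w by algebra+
  then have nz: "(w^4 + w^2) * u * v \<noteq> 0" "w^4 * u * v \<noteq> 0" "(w^4 + w) * u * v \<noteq> 0"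
    "u * v \<noteq> 0" "w * u * v \<noteq> 0" "(w^3 + w) * u * v \<noteq> 0"
    using \<open>u \<noteq> 0\<close> \<open>v \<noteq> 0\<close> by simp_all
  have neq: "x \<noteq> y" if "25 * (x - y) = - 5 * d" "d \<noteq> 0" for x y d :: 'a
    using that five by auto
  show "(a1 - a2 + a3) * a3 \<noteq> (a3 - a4) * a4"
    by (rule neq[OF _ nz(1)], rule trans[OF _ minor(1)]) (simp add: algebra_simps)
  show "(a1 - a2 + a3) * a2 \<noteq> a1 * a4"
    by (rule neq[OF _ nz(2)], rule trans[OF _ minor(2)]) (simp add: algebra_simps)
  show "(a1 - a2 + a3) * a1 \<noteq> (a1 - a2 + a3 - a4) * a4"
    by (rule neq[OF _ nz(3)], rule trans[OF _ minor(3)]) (simp add: algebra_simps)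
  show "(a3 - a4) * a2 \<noteq> a1 * a3"
    by (rule neq[OF _ nz(4)], rule trans[OF _ minor(4)]) (simp add: algebra_simps)
  show "(a3 - a4) * a1 \<noteq> (a1 - a2 + a3 - a4) * a3"
    by (rule neq[OF _ nz(5)], rule trans[OF _ minor(5)]) (simp add: algebra_simps)
  show "a1 * a1 \<noteq> (a1 - a2 + a3 - a4) * a2"
    by (rule neq[OF _ nz(6)], rule trans[OF _ minor(6)]) (simp add: algebra_simps)
qed

section \<open>From the arithmetic conditions to the code\<close>

theorem theorem5p2:
  fixes p \<alpha> q :: nat
    and a1 a2 a3 a4 :: int
    and \<zeta> H :: complex
    and \<sigma>2 :: "complex \<Rightarrow> complex"
    and D :: "'a::{field,finite}^2^4"
  assumes "prime p" and "[p = 1] (mod 5)"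
    and "\<alpha> \<ge> 1" and "q = p ^ \<alpha>"
    and card_field: "CARD('a) = q"
    and zeta: "\<zeta> = exp (2 * of_real pi * \<i> / 5)"
    and H: "H = of_int a1 * \<zeta> + of_int a2 * \<zeta>^2 + of_int a3 * \<zeta>^3 + of_int a4 * \<zeta>^4"
    and sigma2: "is_field_automorphism (rat_adjoin \<zeta>) \<sigma>2" "\<sigma>2 \<zeta> = \<zeta>^2"
    and i: "real q = of_int (a1^2 + a2^2 + a3^2 + a4^2)
              - 1/2 * of_int (a1*a2 + a2*a3 + a3*a4 + a1*a3 + a2*a4 + a1*a4)"
    and ii: "a1*a2 + a2*a3 + a3*a4 = a1*a3 + a2*a4 + a1*a4"
    and iii: "[1 + a1 + a2 + a3 + a4 = 0] (mod 5)"
    and iv: "[a1 + 2*a2 + 3*a3 + 4*a4 = 0] (mod 5)"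
    and v: "\<not> dvd_in (int_adjoin \<zeta>) (of_nat p) (H * \<sigma>2 H)"
    and D: "D = vector [
              vector [of_int (a1 - a2 + a3), of_int a4],
              vector [of_int (a3 - a4), of_int a3],
              vector [of_int a1, of_int a2],
              vector [of_int (a1 - a2 + a3 - a4), of_int a1]]"
  shows "(\<forall>i j. i \<noteq> j \<longrightarrow> row i D \<noteq> row j D \<and> vec.independent {row i D, row j D})
       \<and> (\<exists>C. is_generator_matrix (transpose D) C \<and> is_code 4 2 3 C \<and> is_MDS C)"
proof -
  have char: "CHAR('a) = p"
    using CHAR_eq_if_CARD_prime_power \<open>prime p\<close> card_field \<open>q = p ^ \<alpha>\<close> by blast
  have "p \<noteq> 5"
    using \<open>[p = 1] (mod 5)\<close> by (auto simp: cong_def)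
  then have "\<not> p dvd 5"
    using \<open>prime p\<close> primes_dvd_imp_eq[of p 5] by auto
  then have five: "(5::'a) \<noteq> 0"
    using of_nat_eq_0_iff_char_dvd[of 5, where 'a = 'a] char by simp
  have "[CARD('a) = 1 ^ \<alpha>] (mod 5)"
    unfolding card_field \<open>q = p ^ \<alpha>\<close> using \<open>[p = 1] (mod 5)\<close> by (rule cong_pow)
  then have "CARD('a) mod 5 = 1"
    by (simp add: cong_def)
  then obtain w0 :: 'a where w0: "1 + w0 + w0^2 + w0^3 + w0^4 = 0"
    by (rule exists_primitive_fifth_root)
  \<comment> \<open>The values of \<open>h\<close> at the primitive fifth roots are the images of H
    under the ring homomorphisms from Z[\<zeta>] to the finite field.\<close>
  define h :: "'a \<Rightarrow> 'a" where
    "h x = of_int a1 * x + of_int a2 * x^2 + of_int a3 * x^3 + of_int a4 * x^4" for x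
  \<comment> \<open>The coefficients of H \<sigma>2(H) as given by
    \<open>mult_sigma2_expansion\<close>.\<close>
  define c0 where "c0 = a1*a2 + a2*a4 + a1*a3 + a3*a4"
  define c1 where "c1 = a2^2 + a3*a4 + a1*a4"
  define c2 where "c2 = a4^2 + a1*a3 + a2*a3"
  define c3 where "c3 = a1^2 + a2*a3 + a2*a4"
  define c4 where "c4 = a3^2 + a1*a4 + a1*a2"
  have "\<zeta> ^ 5 = exp (of_nat 5 * (2 * of_real pi * \<i> / 5))"
    unfolding zeta by (rule exp_of_nat_mult[symmetric])
  also have "of_nat 5 * (2 * of_real pi * \<i> / 5) = 2 * of_real pi * \<i>"
    by simp
  finally have "\<zeta> ^ 5 = 1"
    by (simp only: exp_two_pi_i)
  have "\<zeta> \<noteq> 1"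
  proof
    assume "\<zeta> = 1"
    then obtain n :: int where "2 * pi / 5 = of_int (2 * n) * pi"
      by (auto simp: zeta exp_eq_1)
    then have "real_of_int (5 * n) = of_int 1"
      by (simp add: field_simps)
    then have "5 * n = 1"
      by linarith
    then show False
      by presburger
  qed
  have z: "1 + \<zeta> + \<zeta>^2 + \<zeta>^3 + \<zeta>^4 = 0"
    using sum_powers_eq_0_if_power_5_eq_1 \<open>\<zeta> ^ 5 = 1\<close> \<open>\<zeta> \<noteq> 1\<close> by blast
  note K = subfield_rat_adjoin[of \<zeta>]
  have "\<zeta> \<in> rat_adjoin \<zeta>"
    by (auto simp: rat_adjoin_def)
  note mem = of_int_mem_subfield[OF K] power_mem_subfield[OF K \<open>\<zeta> \<in> rat_adjoin \<zeta>\<close>]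
    \<open>\<zeta> \<in> rat_adjoin \<zeta>\<close>
  have add: "x + y \<in> rat_adjoin \<zeta>" "\<sigma>2 (x + y) = \<sigma>2 x + \<sigma>2 y"
   and mult: "x * y \<in> rat_adjoin \<zeta>" "\<sigma>2 (x * y) = \<sigma>2 x * \<sigma>2 y"
    if "x \<in> rat_adjoin \<zeta>" "y \<in> rat_adjoin \<zeta>" for x y
    using that K sigma2(1) by (simp_all add: is_subfield_def is_field_automorphism_def)
  have sigma2_H: "\<sigma>2 H
      = of_int a1 * \<zeta>^2 + of_int a2 * (\<zeta>^2)^2 + of_int a3 * (\<zeta>^2)^3 + of_int a4 * (\<zeta>^2)^4"
    unfolding H
    by (simp add: add mult mem sigma2(2) field_automorphism_of_int[OF K sigma2(1)]
        field_automorphism_power[OF K sigma2(1)])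
  have "H * \<sigma>2 H
      = of_int c0 + of_int c1 * \<zeta> + of_int c2 * \<zeta>^2 + of_int c3 * \<zeta>^3 + of_int c4 * \<zeta>^4"
    unfolding sigma2_H unfolding H fifth_root_powers[OF z] mult_sigma2_expansion[OF z]
    by (simp add: c0_def c1_def c2_def c3_def c4_def)
  \<comment> \<open>Subtracting this zero leaves the differences from \<open>c0\<close> as
    coefficients; these are what will be shown divisible by p.\<close>
  moreover have "of_int c0 * (1 + \<zeta> + \<zeta>^2 + \<zeta>^3 + \<zeta>^4) = 0"
    by (simp only: z mult_zero_right)
  ultimately have HH: "H * \<sigma>2 H = of_int (c1 - c0) * \<zeta> + of_int (c2 - c0) * \<zeta>^2
      + of_int (c3 - c0) * \<zeta>^3 + of_int (c4 - c0) * \<zeta>^4"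
    by (simp add: algebra_simps)
  txt \<open>If h(w) h(w^2) = 0 for all four w, then the integer coefficients of H \<sigma>2(H), reduced modulo
    z^5 = 1, all agree modulo p, and p divides H \<sigma>2(H).\<close>
  have "\<exists>w. 1 + w + w^2 + w^3 + w^4 = 0 \<and> h w * h (w^2) \<noteq> 0"
  proof (rule ccontr)
    assume "\<not> ?thesis"
    then have zero: "h w * h (w^2) = 0" if "1 + w + w^2 + w^3 + w^4 = 0" for w
      using that by blast
    have eq: "of_int c0 + of_int c1 * w + of_int c2 * w^2 + of_int c3 * w^3 + of_int c4 * w^4 = 0"
      if "1 + w + w^2 + w^3 + w^4 = 0" for w :: 'a
      using zero[OF that]
      unfolding h_def fifth_root_powers[OF that] mult_sigma2_expansion[OF that]
      by (simp add: c0_def c1_def c2_def c3_def c4_def)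
    have eqs: "(of_int c1 :: 'a) = of_int c0" "(of_int c2 :: 'a) = of_int c0"
      "(of_int c3 :: 'a) = of_int c0" "(of_int c4 :: 'a) = of_int c0"
      by (rule coeffs_eq_if_zero_at_fifth_roots[OF w0 five eq], assumption)+
    have dvd: "int p dvd c - c0" if "(of_int c :: 'a) = of_int c0" for c
      using that of_int_eq_0_iff_char_dvd[of "c - c0", where 'a = 'a] char by simp
    obtain d1 d2 d3 d4 where "c1 - c0 = int p * d1" "c2 - c0 = int p * d2"
      "c3 - c0 = int p * d3" "c4 - c0 = int p * d4"
      using eqs[THEN dvd] by (elim dvdE)
    \<comment> \<open>The quotient is an integer polynomial in \<zeta>, hence in Z[\<zeta>], which
      contradicts (v).\<close>
    then have "H * \<sigma>2 H = of_nat p * poly (map_poly of_int [:0, d1, d2, d3, d4:]) \<zeta>"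
      unfolding HH by (simp add: map_poly_pCons algebra_simps eval_nat_numeral)
    then show False
      using v int_adjoin_poly by (auto simp: dvd_in_def)
  qed
  then obtain w where w: "1 + w + w^2 + w^3 + w^4 = 0" and uv: "h w \<noteq> 0" "h (w^2) \<noteq> 0"
    by auto
  define A where "A = a1^2 + a2^2 + a3^2 + a4^2"
  define B where "B = a1*a3 + a2*a4 + a1*a4"
  \<comment> \<open>By (ii) the halved sum in (i) is just \<open>B\<close>, so (i) becomes the
    integer equation q = A - B, and q vanishes in the field.\<close>
  have "a1*a2 + a2*a3 + a3*a4 + a1*a3 + a2*a4 + a1*a4 = 2 * B"
    using ii by (simp add: B_def)
  then have "real_of_int (int q) = of_int (A - B)"
    using i by (simp add: A_def del: of_int_add of_int_mult)
  then have "int q = A - B"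
    by linarith
  moreover have "(of_int (int q) :: 'a) = 0"
    using of_nat_CARD_eq_0[where 'a = 'a] by (simp add: card_field)
  ultimately have AB: "(of_int A :: 'a) = of_int B"
    by simp
  have prod: "h x * h (x^4) = 0" if x: "1 + x + x^2 + x^3 + x^4 = 0" for x
  proof -
    have ii': "of_int a1 * of_int a2 + of_int a2 * of_int a3 + of_int a3 * of_int a4
      = of_int a1 * of_int a3 + of_int a2 * of_int a4 + of_int a1 * (of_int a4 :: 'a)"
      using arg_cong[OF ii, of "of_int :: int \<Rightarrow> 'a"] by simp
    show ?thesis
      using AB
      unfolding h_def fifth_root_powers[OF x] mult_conjugate_expansion[OF x ii']
      by (simp add: A_def B_def)
  qed
  \<comment> \<open>Complex conjugation corresponds to x -> x^4: it pairs w with w^4 and w^2 with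
    w^8 = w^3, so both partners are zeros of \<open>h\<close>.\<close>
  have "h (w^4) = 0"
    using prod[OF w] uv by simp
  moreover have "h ((w^2)^4) = 0"
    using prod[OF cyclotomic_5_powers(1)[OF w]] uv by simp
  ultimately have "of_int a1 * w^3 + of_int a2 * w + of_int a3 * w^4 + of_int a4 * w^2 = 0"
    "of_int a1 * w^4 + of_int a2 * w^3 + of_int a3 * w^2 + of_int a4 * w = 0"
    by (simp_all only: h_def fifth_root_powers[OF w])
  note minors = minors_nonzero_if_conjugates_zero[OF w five this
      uv[unfolded h_def fifth_root_powers[OF w]]]
  \<comment> \<open>The six inequalities cover the unordered pairs of rows; swapping i and j only
    exchanges the two sides.\<close>
  have minor: "D $ i $ 1 * D $ j $ 2 \<noteq> D $ j $ 1 * D $ i $ 2" if "i \<noteq> j" for i j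
    using that minors exhaust_4[of i] exhaust_4[of j]
    by (auto simp: D vector_4 vector_2)
  have "row i D \<noteq> row j D \<and> vec.independent {row i D, row j D}" if "i \<noteq> j" for i j
    using independent_pair_if_minor_nonzero[of "row i D" 1 "row j D" 2] minor[OF that]
    by (simp add: row_def mult.commute)
  then show ?thesis
    using MDS_if_minors_nonzero[OF minor] by auto
qed

end
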